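(* Let $G$ be a finite simple connected graph with non-empty vertex set. Then the following statements are equivalent: (i) every vertex of $G$ belongs to exactly one simplex of $G$; (ii) $G$ is square-stable, i.e. $\alpha(G)=\alpha(G^2)$; (iii) $\theta(G)=\theta(G^2)$; (iv) $\alpha(G^2)=\theta(G^2)=\gamma(G)=i(G)=\alpha(G)=\theta(G)$; (v) $\Omega(G^2)\subseteq\Omega(G)$; (vi) there is some $S\in\Omega(G)$ such that $\mathrm{dist}_G(a,b)\ge 3$ for all distinct $a,b\in S$; (vii) there exists $S_0\in\Omega(G)$ that has property P1; (viii) every $S\in\Omega(G^2)$ has property P1; (ix) for all $S_1\in\Omega(G)$ and $S_2\in\Omega(G^2)$, the graph $G[S_1\bigtriangleup S_2]$ has a unique perfect matching; (x) for all $S_1\in\Omega(G)$ and $S_2\in\Omega(G^2)$, the graph $G[S_1\bigtriangleup S_2]$ has a perfect matching; (xi) for all $S_1\in\Omega(G)$ and $S_2\in\Omega(G^2)$, the graph $G[S_1\bigtriangleup S_2]$ has an induced perfect matching; (xii) there exists $S_0\in\Omega(G)$ that has property P2; (xiii) every $S\in\Omega(G^2)$ has property P2.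
   Context: $G^2$ is the graph on $V(G)$ in which distinct vertices $v,w$ are adjacent iff $\mathrm{dist}_G(v,w)\le 2$. A stable set is a set of pairwise non-adjacent vertices; $\alpha(G)$ is the maximum cardinality of a stable set; $\Omega(G)$ is the set of all maximum (cardinality) stable sets of $G$. $\theta(G)$ is the minimum number of cliques of $G$ whose union is $V(G)$; $i(G)$ is the minimum cardinality of an (inclusion-)maximal stable set; $\gamma(G)$ is the minimum cardinality of a dominating set. A vertex $v$ is simplicial if its neighborhood $N(v)$ induces a complete graph; a simplex is a maximal clique containing at least one simplicial vertex. $G[X]$ is the subgraph induced by $X$, and $A\bigtriangleup B=(A-B)\cup(B-A)$. The graph on the empty vertex set has the empty perfect matching. A matching $M$ of $G$ is induced if no edge of $G$ joins endpoints of two different edges of $M$. A stable set $S$ of $G$ has property P1 if for every stable set $A$ of $G$ disjoint from $S$, $A$ can be uniquely matched into $S$: there is exactly one matching, consisting of edges of $G$ with one end in $A$ and the other in $S$, that saturates all vertices of $A$. A stable set $S$ of $G$ has property P2 if for every stable set $A$ of $G$ disjoint from $S$ there is a (not necessarily proper) subset $S^*\subseteq S$ such that $A\cup S^*\in\Omega(G)$. *)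

theory Defs
  imports "Graph_Theory.Digraph_Component" "Graph_Theory.Shortest_Path"
begin

text \<open>
  A finite simple graph is a \<^locale>\<open>graph\<close>: a finite symmetric digraph without loops and
  parallel arcs. Adjacency of \<open>u\<close> and \<open>v\<close> is \<open>u \<rightarrow>\<^bsub>G\<^esub> v\<close>.
\<close>

definition tfae :: "bool list \<Rightarrow> bool" where
  "tfae ps \<longleftrightarrow> (\<forall>p \<in> set ps. \<forall>q \<in> set ps. p \<longrightarrow> q)"


subsection \<open>Distance and the square of a graph\<close>

definition gdist :: "('a,'b) pre_digraph \<Rightarrow> 'a \<Rightarrow> 'a \<Rightarrow> ereal" where
  "gdist G u v = wf_digraph.\<mu> G (\<lambda>_. 1) u v"

definition graph_square :: "('a,'b) pre_digraph \<Rightarrow> ('a, 'a \<times> 'a) pre_digraph" where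
  "graph_square G = with_proj \<lparr> pverts = verts G,
     parcs = {(v, w). v \<in> verts G \<and> w \<in> verts G \<and> v \<noteq> w \<and> gdist G v w \<le> 2} \<rparr>"


subsection \<open>Stable, dominating and complete sets of vertices\<close>

definition stable_set :: "('a,'b) pre_digraph \<Rightarrow> 'a set \<Rightarrow> bool" where
  "stable_set G S \<longleftrightarrow> S \<subseteq> verts G \<and> (\<forall>u \<in> S. \<forall>v \<in> S. u \<noteq> v \<longrightarrow> \<not> u \<rightarrow>\<^bsub>G\<^esub> v)"

definition stability_number :: "('a,'b) pre_digraph \<Rightarrow> nat" where
  "stability_number G = Max (card ` {S. stable_set G S})"

definition max_stable_sets :: "('a,'b) pre_digraph \<Rightarrow> 'a set set" where
  "max_stable_sets G = {S. stable_set G S \<and> card S = stability_number G}"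

definition maximal_stable_set :: "('a,'b) pre_digraph \<Rightarrow> 'a set \<Rightarrow> bool" where
  "maximal_stable_set G S \<longleftrightarrow> stable_set G S \<and> (\<forall>T. stable_set G T \<and> S \<subseteq> T \<longrightarrow> T = S)"

definition independent_domination_number :: "('a,'b) pre_digraph \<Rightarrow> nat" where
  "independent_domination_number G = Min (card ` {S. maximal_stable_set G S})"

definition dominating_set :: "('a,'b) pre_digraph \<Rightarrow> 'a set \<Rightarrow> bool" where
  "dominating_set G D \<longleftrightarrow> D \<subseteq> verts G \<and> (\<forall>v \<in> verts G - D. \<exists>u \<in> D. v \<rightarrow>\<^bsub>G\<^esub> u)"

definition domination_number :: "('a,'b) pre_digraph \<Rightarrow> nat" where
  "domination_number G = Min (card ` {D. dominating_set G D})"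

definition is_clique :: "('a,'b) pre_digraph \<Rightarrow> 'a set \<Rightarrow> bool" where
  "is_clique G Q \<longleftrightarrow> Q \<subseteq> verts G \<and> (\<forall>u \<in> Q. \<forall>v \<in> Q. u \<noteq> v \<longrightarrow> u \<rightarrow>\<^bsub>G\<^esub> v)"

definition clique_cover_number :: "('a,'b) pre_digraph \<Rightarrow> nat" where
  "clique_cover_number G = Min (card ` {C. (\<forall>Q \<in> C. is_clique G Q) \<and> \<Union>C = verts G})"

definition maximal_clique :: "('a,'b) pre_digraph \<Rightarrow> 'a set \<Rightarrow> bool" where
  "maximal_clique G Q \<longleftrightarrow> is_clique G Q \<and> (\<forall>R. is_clique G R \<and> Q \<subseteq> R \<longrightarrow> R = Q)"

definition neighborhood :: "('a,'b) pre_digraph \<Rightarrow> 'a \<Rightarrow> 'a set" where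
  "neighborhood G v = {w. v \<rightarrow>\<^bsub>G\<^esub> w}"

definition simplicial :: "('a,'b) pre_digraph \<Rightarrow> 'a \<Rightarrow> bool" where
  "simplicial G v \<longleftrightarrow> v \<in> verts G \<and> is_clique G (neighborhood G v)"

definition simplex :: "('a,'b) pre_digraph \<Rightarrow> 'a set \<Rightarrow> bool" where
  "simplex G Q \<longleftrightarrow> maximal_clique G Q \<and> (\<exists>v \<in> Q. simplicial G v)"


subsection \<open>Matchings\<close>

text \<open>
  A matching is a set of undirected edges: the two arcs \<open>(u, v)\<close> and \<open>(v, u)\<close> must not be
  counted as different edges, since matchings are required to be unique below.
\<close>

definition undirected_edges :: "('a,'b) pre_digraph \<Rightarrow> 'a set set" where
  "undirected_edges G = {{u, v} | u v. u \<rightarrow>\<^bsub>G\<^esub> v}"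

definition is_matching :: "('a,'b) pre_digraph \<Rightarrow> 'a set set \<Rightarrow> bool" where
  "is_matching G M \<longleftrightarrow> M \<subseteq> undirected_edges G \<and> (\<forall>e \<in> M. \<forall>f \<in> M. e \<noteq> f \<longrightarrow> e \<inter> f = {})"

definition perfect_matching :: "('a,'b) pre_digraph \<Rightarrow> 'a set set \<Rightarrow> bool" where
  "perfect_matching G M \<longleftrightarrow> is_matching G M \<and> \<Union>M = verts G"

definition induced_matching :: "('a,'b) pre_digraph \<Rightarrow> 'a set set \<Rightarrow> bool" where
  "induced_matching G M \<longleftrightarrow> is_matching G M \<and>
     (\<forall>e \<in> M. \<forall>f \<in> M. e \<noteq> f \<longrightarrow> (\<forall>u \<in> e. \<forall>v \<in> f. \<not> u \<rightarrow>\<^bsub>G\<^esub> v))"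

definition uniquely_matched_into :: "('a,'b) pre_digraph \<Rightarrow> 'a set \<Rightarrow> 'a set \<Rightarrow> bool" where
  "uniquely_matched_into G A S \<longleftrightarrow>
     (\<exists>!M. is_matching G M \<and> (\<forall>e \<in> M. \<exists>a \<in> A. \<exists>s \<in> S. e = {a, s}) \<and> A \<subseteq> \<Union>M)"

definition property_P1 :: "('a,'b) pre_digraph \<Rightarrow> 'a set \<Rightarrow> bool" where
  "property_P1 G S \<longleftrightarrow> stable_set G S \<and>
     (\<forall>A. stable_set G A \<and> A \<inter> S = {} \<longrightarrow> uniquely_matched_into G A S)"

definition property_P2 :: "('a,'b) pre_digraph \<Rightarrow> 'a set \<Rightarrow> bool" where
  "property_P2 G S \<longleftrightarrow> stable_set G S \<and>
     (\<forall>A. stable_set G A \<and> A \<inter> S = {} \<longrightarrow> (\<exists>S' \<subseteq> S. A \<union> S' \<in> max_stable_sets G))"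

end

theory Submission
  imports Defs
begin

text \<open>
  All thirteen statements are shown equivalent to one condition: some maximum stable set \<open>S\<close>
  of \<open>G\<close> is a \<^emph>\<open>2-packing\<close>, that is, the closed neighborhoods of its vertices are
  pairwise disjoint. Two closed neighborhoods are disjoint exactly when the distance of their centers
  is at least 3, so the 2-packings are the stable sets of \<open>G\<^sup>2\<close>, and the conditions that speak
  about \<open>\<alpha>\<close>, \<open>\<Omega>\<close> and distances are reformulations of this one.

  Such an \<open>S\<close> determines the structure of \<open>G\<close>. Being maximal, \<open>S\<close> dominates, so
  the closed neighborhoods of its vertices partition the vertex set. Each of them is a clique, since
  otherwise \<open>s \<in> S\<close> could be exchanged for two non-adjacent neighbors
  (\<open>closed_neighborhood_clique\<close>). These cliques are precisely the simplices of \<open>G\<close>,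
  and a vertex outside \<open>S\<close> has exactly one neighbor in \<open>S\<close>, which differs for
  distinct members of a stable set. So the edges between \<open>S\<close> and a stable set disjoint from
  \<open>S\<close> form a matching, and no other matching between the two saturates that set. This gives
  P1, P2 and the unique induced perfect matchings.

  For the parameters, \<open>\<alpha>(G\<^sup>2) \<le> \<theta>(G\<^sup>2) \<le> \<gamma>(G) \<le> i(G) \<le> \<alpha>(G) \<le> \<theta>(G)\<close> holds in every graph, and the
  clique partition shows \<open>\<theta>(G) \<le> card S \<le> \<alpha>(G\<^sup>2)\<close>, which collapses the chain.

  Conversely, P1 or P2 applied to a single vertex \<open>v\<close> outside \<open>S\<close> forbids two neighbors of
  \<open>v\<close> in \<open>S\<close>; and where a statement quantifies over the maximum stable sets of
  \<open>G\<^sup>2\<close>, it either says or implies, by comparing cardinalities, that one of them is also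
  maximum in \<open>G\<close>. The least obvious converse starts from \<open>\<theta>(G) = \<theta>(G\<^sup>2)\<close>. If every vertex of some
  clique \<open>Q\<close> in a minimum clique cover of \<open>G\<close> had a closed neighborhood meeting another
  clique of the cover, then distributing the vertices of \<open>Q\<close> over these other cliques would
  cover \<open>G\<^sup>2\<close> by fewer cliques (\<open>clique_cover_number_square_less\<close>). Hence every clique of
  the cover has a vertex whose closed neighborhood avoids all others, and these vertices form a
  2-packing that is as large as a clique cover, hence a maximum stable set. The same argument
  handles the cover by simplices.
\<close>

section \<open>Closed neighborhoods and 2-packings\<close>

definition closed_neighborhood :: "('a,'b) pre_digraph \<Rightarrow> 'a \<Rightarrow> 'a set" where
  "closed_neighborhood G v = insert v (neighborhood G v)"

definition two_packing :: "('a,'b) pre_digraph \<Rightarrow> 'a set \<Rightarrow> bool" where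
  "two_packing G S \<longleftrightarrow> S \<subseteq> verts G \<and>
     (\<forall>a \<in> S. \<forall>b \<in> S. a \<noteq> b \<longrightarrow> closed_neighborhood G a \<inter> closed_neighborhood G b = {})"

definition clique_cover :: "('a,'b) pre_digraph \<Rightarrow> 'a set set \<Rightarrow> bool" where
  "clique_cover G C \<longleftrightarrow> (\<forall>Q \<in> C. is_clique G Q) \<and> \<Union>C = verts G"

lemma in_closed_neighborhood_iff: "w \<in> closed_neighborhood G v \<longleftrightarrow> w = v \<or> v \<rightarrow>\<^bsub>G\<^esub> w"
  by (auto simp: closed_neighborhood_def neighborhood_def)

lemma two_packingD:
  assumes "two_packing G S" "a \<in> S" "b \<in> S"
    and "x \<in> closed_neighborhood G a" "x \<in> closed_neighborhood G b"
  shows "a = b"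
  using assms by (auto simp: two_packing_def)

lemma verts_graph_square [simp]: "verts (graph_square G) = verts G"
  by (simp add: graph_square_def)

lemma clique_subset_closed_neighborhood:
  "is_clique G Q \<Longrightarrow> v \<in> Q \<Longrightarrow> Q \<subseteq> closed_neighborhood G v"
  unfolding is_clique_def subset_iff in_closed_neighborhood_iff by metis

context graph
begin

lemma adjacent_sym: "u \<rightarrow> v \<Longrightarrow> v \<rightarrow> u"
  using arcs_ends_symmetric[OF sym_arcs] .

lemma in_closed_neighborhood_sym:
  "w \<in> closed_neighborhood G v \<longleftrightarrow> v \<in> closed_neighborhood G w"
  unfolding in_closed_neighborhood_iff using adjacent_sym by blast

lemma closed_neighborhood_subset: "v \<in> verts G \<Longrightarrow> closed_neighborhood G v \<subseteq> verts G"
  by (auto simp: in_closed_neighborhood_iff adj_in_verts)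

lemma awalk_cost_one: "awalk_cost (\<lambda>_. 1) p = length p"
  by (induction p) auto

lemma gdist_le_2:
  assumes "u \<in> verts G" "v \<in> verts G"
    and "closed_neighborhood G u \<inter> closed_neighborhood G v \<noteq> {}"
  shows "gdist G u v \<le> 2"
proof -
  obtain z where z: "z \<in> closed_neighborhood G u" "v \<in> closed_neighborhood G z"
    using assms in_closed_neighborhood_sym by blast
  have short: "\<exists>p. awalk x p y \<and> length p \<le> 1"
    if "x \<in> verts G" "y \<in> closed_neighborhood G x" for x y
  proof (cases "y = x")
    case True
    then show ?thesis using that by (intro exI[of _ "[]"]) (simp add: awalk_Nil_iff)
  next
    case False
    then have "x \<rightarrow> y" using that by (simp add: in_closed_neighborhood_iff)
    then obtain e where "e \<in> arcs G" "tail G e = x" "head G e = y" by blast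
    then show ?thesis by (intro exI[of _ "[e]"]) (auto simp: awalk_simps)
  qed
  obtain p where p: "awalk u p z" "length p \<le> 1" using short assms(1) z(1) by blast
  moreover obtain q where q: "awalk z q v" "length q \<le> 1"
    using short awalk_last_in_verts[OF p(1)] z(2) by blast
  ultimately have "awalk u (p @ q) v" by (intro awalk_appendI)
  then have "\<mu> (\<lambda>_. 1) u v \<le> awalk_cost (\<lambda>_. 1) (p @ q)" by (rule min_cost_le_walk_cost)
  also have "\<dots> \<le> ereal 2" using p(2) q(2) by (simp only: awalk_cost_one) simp
  finally show ?thesis by (simp add: gdist_def)
qed

text \<open>
  The bound is strict and equals 3 because \<^const>\<open>gdist\<close> is an infimum of extended reals: an infimum
  below 3 is undercut by the length of some walk, and that length, an integer, is at most 2. Hence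
  no distance lies strictly between 2 and 3.
\<close>

lemma gdist_less_3:
  assumes "gdist G u v < 3"
  shows "closed_neighborhood G u \<inter> closed_neighborhood G v \<noteq> {}"
proof -
  obtain p where p: "awalk u p v" "ereal (awalk_cost (\<lambda>_. 1) p) < 3"
    using assms by (auto simp: gdist_def \<mu>_def INF_less_iff)
  then have "ereal (length p) < ereal 3" by (simp only: awalk_cost_one) simp
  then have "length p \<le> 2" by simp
  then consider "p = []" | e where "p = [e]" | e f where "p = [e, f]"
    by (metis One_nat_def Suc_1 le_Suc_eq le_zero_eq length_0_conv length_Suc_conv)
  then show ?thesis
  proof cases
    case 1
    then show ?thesis using p(1) by (auto simp: awalk_simps closed_neighborhood_def)
  next
    case 2
    then have "u \<rightarrow> v" using p(1) by (auto simp: awalk_simps intro: in_arcs_imp_in_arcs_ends)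
    then show ?thesis by (auto simp: in_closed_neighborhood_iff)
  next
    case 3
    then have "e \<in> arcs G" "f \<in> arcs G" "u = tail G e" "head G e = tail G f" "head G f = v"
      using p(1) by (auto simp: awalk_simps)
    then have "u \<rightarrow> tail G f" "tail G f \<rightarrow> v"
      using in_arcs_imp_in_arcs_ends[of e] in_arcs_imp_in_arcs_ends[of f] by simp_all
    then have "tail G f \<in> closed_neighborhood G u" "tail G f \<in> closed_neighborhood G v"
      unfolding in_closed_neighborhood_iff using adjacent_sym by blast+
    then show ?thesis by blast
  qed
qed

lemma gdist_ge_3_iff:
  assumes "u \<in> verts G" "v \<in> verts G"
  shows "gdist G u v \<ge> 3 \<longleftrightarrow> closed_neighborhood G u \<inter> closed_neighborhood G v = {}"
proof
  assume ge: "gdist G u v \<ge> 3"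
  have "(2::ereal) < 3" by simp
  then have "\<not> gdist G u v \<le> 2" using ge by (meson leD order.strict_trans2)
  then show "closed_neighborhood G u \<inter> closed_neighborhood G v = {}"
    using gdist_le_2 assms by blast
next
  assume "closed_neighborhood G u \<inter> closed_neighborhood G v = {}"
  then show "gdist G u v \<ge> 3" using gdist_less_3 not_le by blast
qed

lemma adjacent_graph_square_iff:
  assumes "u \<in> verts G" "v \<in> verts G"
  shows "u \<rightarrow>\<^bsub>graph_square G\<^esub> v \<longleftrightarrow>
    u \<noteq> v \<and> closed_neighborhood G u \<inter> closed_neighborhood G v \<noteq> {}"
proof -
  have "gdist G u v \<le> 2 \<longleftrightarrow> closed_neighborhood G u \<inter> closed_neighborhood G v \<noteq> {}"
  proof
    assume le: "gdist G u v \<le> 2"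
    have "(2::ereal) < 3" by simp
    then have "gdist G u v < 3" using le by (rule le_less_trans[rotated])
    then show "closed_neighborhood G u \<inter> closed_neighborhood G v \<noteq> {}" by (rule gdist_less_3)
  qed (use assms gdist_le_2 in blast)
  then show ?thesis using assms by (simp add: graph_square_def)
qed

lemma stable_set_graph_square_iff: "stable_set (graph_square G) S \<longleftrightarrow> two_packing G S"
proof (cases "S \<subseteq> verts G")
  case True
  then have "\<And>u v. u \<in> S \<Longrightarrow> v \<in> S \<Longrightarrow> u \<rightarrow>\<^bsub>graph_square G\<^esub> v \<longleftrightarrow>
      u \<noteq> v \<and> closed_neighborhood G u \<inter> closed_neighborhood G v \<noteq> {}"
    by (intro adjacent_graph_square_iff) auto
  then show ?thesis by (simp add: stable_set_def two_packing_def)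
qed (auto simp: stable_set_def two_packing_def)

lemma is_clique_graph_square_iff:
  "is_clique (graph_square G) Q \<longleftrightarrow> Q \<subseteq> verts G \<and>
     (\<forall>u \<in> Q. \<forall>v \<in> Q. closed_neighborhood G u \<inter> closed_neighborhood G v \<noteq> {})"
proof (cases "Q \<subseteq> verts G")
  case True
  then have "\<And>u v. u \<in> Q \<Longrightarrow> v \<in> Q \<Longrightarrow> u \<rightarrow>\<^bsub>graph_square G\<^esub> v \<longleftrightarrow>
      u \<noteq> v \<and> closed_neighborhood G u \<inter> closed_neighborhood G v \<noteq> {}"
    by (intro adjacent_graph_square_iff) auto
  moreover have "closed_neighborhood G u \<inter> closed_neighborhood G u \<noteq> {}" for u
    by (auto simp: closed_neighborhood_def)
  ultimately show ?thesis using True unfolding is_clique_def verts_graph_square by metis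
qed (auto simp: is_clique_def)

lemma two_packing_iff_gdist:
  assumes "S \<subseteq> verts G"
  shows "two_packing G S \<longleftrightarrow> (\<forall>a \<in> S. \<forall>b \<in> S. a \<noteq> b \<longrightarrow> gdist G a b \<ge> 3)"
proof -
  have "\<And>a b. a \<in> S \<Longrightarrow> b \<in> S \<Longrightarrow> gdist G a b \<ge> 3 \<longleftrightarrow>
      closed_neighborhood G a \<inter> closed_neighborhood G b = {}"
    using assms by (intro gdist_ge_3_iff) auto
  then show ?thesis using assms by (simp add: two_packing_def)
qed

lemma two_packing_imp_stable: "two_packing G S \<Longrightarrow> stable_set G S"
  unfolding two_packing_def stable_set_def
  by (meson disjoint_iff in_closed_neighborhood_iff)

text \<open>
  This form can be tested one vertex \<open>v\<close> at a time, by applying P1 and P2 to the stable set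
  \<open>{v}\<close>.
\<close>

lemma two_packing_iff_unique_neighbor:
  assumes "stable_set G S"
  shows "two_packing G S \<longleftrightarrow>
    (\<forall>v \<in> verts G - S. \<forall>a \<in> S. \<forall>b \<in> S. v \<rightarrow> a \<longrightarrow> v \<rightarrow> b \<longrightarrow> a = b)" (is "?L \<longleftrightarrow> ?R")
proof
  assume pack: ?L
  show ?R
  proof (intro ballI impI)
    fix v a b
    assume "a \<in> S" "b \<in> S" "v \<rightarrow> a" "v \<rightarrow> b"
    then show "a = b"
      using two_packingD[OF pack, of a b v] adjacent_sym by (simp add: in_closed_neighborhood_iff)
  qed
next
  assume unique: ?R
  have "a = b" if "a \<in> S" "b \<in> S" and x: "x \<in> closed_neighborhood G a" "x \<in> closed_neighborhood G b"
    for a b x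
  proof (rule ccontr)
    assume "a \<noteq> b"
    have "x \<notin> S"
      using assms that \<open>a \<noteq> b\<close> unfolding stable_set_def in_closed_neighborhood_iff by metis
    then have "x \<rightarrow> a" "x \<rightarrow> b"
      using x that(1,2) adjacent_sym by (auto simp: in_closed_neighborhood_iff)
    then show False using unique that(1,2) \<open>x \<notin> S\<close> \<open>a \<noteq> b\<close> adj_in_verts by blast
  qed
  then show ?L using assms unfolding two_packing_def stable_set_def by blast
qed

end


section \<open>A chain of parameters\<close>

lemma finite_card_image_Collect:
  assumes "finite V" "\<And>S. P S \<Longrightarrow> S \<subseteq> V"
  shows "finite (card ` {S. P S})"
  using assms by (intro finite_imageI finite_subset[of "{S. P S}" "Pow V"]) auto

lemma card_stable_le_stability_number:
  assumes "finite (verts G)" "stable_set G S"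
  shows "card S \<le> stability_number G"
  unfolding stability_number_def
  using assms(2)
  by (intro Max_ge finite_card_image_Collect[OF assms(1)]) (auto simp: stable_set_def)

lemma max_stable_sets_nonempty:
  assumes "finite (verts G)"
  shows "max_stable_sets G \<noteq> {}"
proof -
  have "stable_set G {}" by (simp add: stable_set_def)
  then have "stability_number G \<in> card ` {S. stable_set G S}"
    unfolding stability_number_def
    by (intro Max_in finite_card_image_Collect[OF assms]) (auto simp: stable_set_def)
  then show ?thesis by (auto simp: max_stable_sets_def)
qed

lemma max_stable_setsI:
  assumes "finite (verts G)" "stable_set G S" "stability_number G \<le> card S"
  shows "S \<in> max_stable_sets G"
  using assms card_stable_le_stability_number[OF assms(1,2)] by (simp add: max_stable_sets_def)

lemma finite_clique_covers:
  assumes "finite (verts G)"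
  shows "finite (card ` {C. clique_cover G C})"
  by (rule finite_card_image_Collect[of "Pow (verts G)"])
    (use assms in \<open>auto simp: clique_cover_def is_clique_def\<close>)

lemma clique_cover_number_eq_Min: "clique_cover_number G = Min (card ` {C. clique_cover G C})"
  by (simp add: clique_cover_number_def clique_cover_def)

lemma clique_cover_number_le:
  assumes "finite (verts G)" "clique_cover G C"
  shows "clique_cover_number G \<le> card C"
  unfolding clique_cover_number_eq_Min
  by (rule Min_le) (use finite_clique_covers assms in auto)

lemma obtain_minimum_clique_cover:
  assumes "finite (verts G)"
  obtains C where "clique_cover G C" "card C = clique_cover_number G"
proof -
  have "clique_cover G ((\<lambda>v. {v}) ` verts G)" by (auto simp: clique_cover_def is_clique_def)
  then have "clique_cover_number G \<in> card ` {C. clique_cover G C}"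
    unfolding clique_cover_number_eq_Min by (intro Min_in finite_clique_covers assms) auto
  then show ?thesis using that by auto
qed

lemma clique_cover_finite: "finite (verts G) \<Longrightarrow> clique_cover G C \<Longrightarrow> finite C"
  by (auto simp: clique_cover_def is_clique_def intro: finite_subset[of C "Pow (verts G)"])

text \<open>
  A clique contains at most one vertex of a stable set, so choosing for each vertex a clique that
  contains it is injective.
\<close>

lemma card_stable_le_card_clique_cover:
  assumes "finite (verts G)" "stable_set G S" "clique_cover G C"
  shows "card S \<le> card C"
proof -
  have "\<forall>v \<in> S. \<exists>Q \<in> C. v \<in> Q" using assms by (auto simp: stable_set_def clique_cover_def)
  then obtain f where f: "\<And>v. v \<in> S \<Longrightarrow> f v \<in> C \<and> v \<in> f v" by metis
  have "inj_on f S"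
  proof (rule inj_onI, rule ccontr)
    fix u v assume "u \<in> S" "v \<in> S" "f u = f v" "u \<noteq> v"
    then have "u \<rightarrow>\<^bsub>G\<^esub> v" using f assms(3) by (metis clique_cover_def is_clique_def)
    then show False using assms(2) \<open>u \<in> S\<close> \<open>v \<in> S\<close> \<open>u \<noteq> v\<close> by (auto simp: stable_set_def)
  qed
  then show ?thesis using f clique_cover_finite[OF assms(1,3)] by (auto intro: card_inj_on_le)
qed

lemma stability_number_le_clique_cover_number:
  assumes "finite (verts G)"
  shows "stability_number G \<le> clique_cover_number G"
proof -
  obtain S where "S \<in> max_stable_sets G" using max_stable_sets_nonempty[OF assms] by blast
  moreover obtain C where "clique_cover G C" "card C = clique_cover_number G"
    using obtain_minimum_clique_cover[OF assms] .
  ultimately show ?thesis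
    using card_stable_le_card_clique_cover[OF assms] by (fastforce simp: max_stable_sets_def)
qed

context graph
begin

text \<open>
  A closed neighborhood is a clique of the square, because its center is a common member of all the
  closed neighborhoods involved, and the closed neighborhoods around a dominating set cover the
  graph.
\<close>

lemma clique_cover_number_square_le_domination_number:
  "clique_cover_number (graph_square G) \<le> domination_number G"
proof -
  have "finite (card ` {D. dominating_set G D})"
    by (rule finite_card_image_Collect[of "verts G"]) (auto simp: dominating_set_def)
  moreover have "dominating_set G (verts G)" by (simp add: dominating_set_def)
  ultimately have "domination_number G \<in> card ` {D. dominating_set G D}"
    unfolding domination_number_def by (intro Min_in) auto
  then obtain D where D: "dominating_set G D" "card D = domination_number G" by auto
  have D_verts: "D \<subseteq> verts G" using D(1) by (simp add: dominating_set_def)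
  have "is_clique (graph_square G) (closed_neighborhood G d)" if "d \<in> D" for d
    unfolding is_clique_graph_square_iff
    using that D_verts closed_neighborhood_subset in_closed_neighborhood_sym by blast
  moreover have "v \<in> \<Union> (closed_neighborhood G ` D)" if "v \<in> verts G" for v
  proof (cases "v \<in> D")
    case False
    then obtain u where "u \<in> D" "v \<rightarrow> u" using D(1) \<open>v \<in> verts G\<close>
      by (auto simp: dominating_set_def)
    then show ?thesis using adjacent_sym by (auto simp: in_closed_neighborhood_iff)
  qed (auto simp: in_closed_neighborhood_iff)
  ultimately have "clique_cover (graph_square G) (closed_neighborhood G ` D)"
    using D_verts closed_neighborhood_subset by (fastforce simp: clique_cover_def)
  then have "clique_cover_number (graph_square G) \<le> card (closed_neighborhood G ` D)"
    by (intro clique_cover_number_le) simp_all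
  also have "\<dots> \<le> card D" using D_verts by (intro card_image_le) (rule finite_subset, auto)
  finally show ?thesis using D(2) by simp
qed

lemma maximal_stable_set_dominating:
  assumes "maximal_stable_set G S"
  shows "dominating_set G S"
proof -
  have S: "stable_set G S" and maximal: "\<And>T. stable_set G T \<Longrightarrow> S \<subseteq> T \<Longrightarrow> T = S"
    using assms by (auto simp: maximal_stable_set_def)
  have "\<exists>u \<in> S. v \<rightarrow> u" if v: "v \<in> verts G - S" for v
  proof (rule ccontr)
    assume "\<not> (\<exists>u \<in> S. v \<rightarrow> u)"
    then have "stable_set G (insert v S)"
      using S v adjacent_sym by (auto simp: stable_set_def)
    then show False using maximal[of "insert v S"] v by blast
  qed
  then show ?thesis using S by (auto simp: dominating_set_def stable_set_def)
qed

lemma max_stable_set_is_maximal: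
  assumes "S \<in> max_stable_sets G"
  shows "maximal_stable_set G S"
  unfolding maximal_stable_set_def
proof (intro conjI allI impI)
  show "stable_set G S" using assms by (simp add: max_stable_sets_def)
  fix T assume T: "stable_set G T \<and> S \<subseteq> T"
  then have "finite T" by (auto simp: stable_set_def intro: finite_subset)
  moreover have "card T \<le> card S"
    using T assms card_stable_le_stability_number[of G T] by (simp add: max_stable_sets_def)
  ultimately show "T = S" using T by (metis card_seteq)
qed

lemma obtain_minimum_maximal_stable_set:
  obtains S where "maximal_stable_set G S" "card S = independent_domination_number G"
proof -
  have "finite (card ` {S. maximal_stable_set G S})"
    by (rule finite_card_image_Collect[of "verts G"])
      (auto simp: maximal_stable_set_def stable_set_def)
  moreover have "{S. maximal_stable_set G S} \<noteq> {}"
    using max_stable_sets_nonempty[of G] max_stable_set_is_maximal by auto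
  ultimately have "independent_domination_number G \<in> card ` {S. maximal_stable_set G S}"
    unfolding independent_domination_number_def by (intro Min_in) auto
  then show ?thesis using that by auto
qed

lemma domination_number_le_independent_domination_number:
  "domination_number G \<le> independent_domination_number G"
proof -
  obtain S where S: "maximal_stable_set G S" "card S = independent_domination_number G"
    using obtain_minimum_maximal_stable_set .
  have "finite (card ` {D. dominating_set G D})"
    by (rule finite_card_image_Collect[of "verts G"]) (auto simp: dominating_set_def)
  then have "domination_number G \<le> card S"
    unfolding domination_number_def using maximal_stable_set_dominating[OF S(1)]
    by (intro Min_le) auto
  then show ?thesis using S(2) by simp
qed

lemma independent_domination_number_le_stability_number:
  "independent_domination_number G \<le> stability_number G"
  using obtain_minimum_maximal_stable_set card_stable_le_stability_number[of G]
  by (metis maximal_stable_set_def finite_verts)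

text \<open>
  The chain \<open>\<alpha>(G\<^sup>2) \<le> \<theta>(G\<^sup>2) \<le> \<gamma>(G) \<le> i(G) \<le> \<alpha>(G) \<le> \<theta>(G)\<close>, valid in every graph.
\<close>

lemmas parameter_chain =
  stability_number_le_clique_cover_number[of "graph_square G", simplified]
  clique_cover_number_square_le_domination_number
  domination_number_le_independent_domination_number
  independent_domination_number_le_stability_number
  stability_number_le_clique_cover_number[of G, simplified]


section \<open>Maximum stable 2-packings from clique covers\<close>

text \<open>
  One private vertex per clique yields a stable set with as many vertices as the cover has cliques,
  and no stable set is larger than a clique cover. The closed neighborhood of a private vertex lies
  inside its clique, so two such neighborhoods cannot meet.
\<close>

lemma max_stable_two_packing_if_private_vertices:
  assumes cover: "clique_cover G C"
    and private_vertex: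
      "\<And>Q. Q \<in> C \<Longrightarrow> \<exists>v \<in> Q. closed_neighborhood G v \<inter> \<Union> (C - {Q}) = {}"
  shows "\<exists>S \<in> max_stable_sets G. two_packing G S"
proof -
  obtain c where c: "\<And>Q. Q \<in> C \<Longrightarrow> c Q \<in> Q"
      "\<And>Q. Q \<in> C \<Longrightarrow> closed_neighborhood G (c Q) \<inter> \<Union> (C - {Q}) = {}"
    using private_vertex by metis
  have subset: "closed_neighborhood G (c Q) \<subseteq> Q" if "Q \<in> C" for Q
  proof -
    have "c Q \<in> verts G" using that c(1) cover by (auto simp: clique_cover_def)
    then have "closed_neighborhood G (c Q) \<subseteq> \<Union>C"
      using closed_neighborhood_subset cover by (auto simp: clique_cover_def)
    then show ?thesis using c(2)[OF that] by blast
  qed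
  have disjoint: "closed_neighborhood G (c Q) \<inter> closed_neighborhood G (c R) = {}"
    if "Q \<in> C" "R \<in> C" "Q \<noteq> R" for Q R
    using c(2)[OF that(1)] subset[OF that(2)] that by blast
  then have "inj_on c C"
    by (intro inj_onI) (metis Int_absorb closed_neighborhood_def insert_not_empty)
  then have card: "card (c ` C) = card C" by (rule card_image)
  have pack: "two_packing G (c ` C)"
    unfolding two_packing_def using c(1) cover disjoint by (fastforce simp: clique_cover_def)
  have "stability_number G \<le> clique_cover_number G"
    by (rule stability_number_le_clique_cover_number) simp
  also have "\<dots> \<le> card (c ` C)"
    using card clique_cover_number_le[OF _ cover] by simp
  finally have "c ` C \<in> max_stable_sets G"
    using two_packing_imp_stable[OF pack] by (intro max_stable_setsI) auto
  then show ?thesis using pack by blast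
qed

text \<open>
  If \<open>v \<in> Q\<close> has a member of \<open>R\<close> in its closed neighborhood, it is within distance 2 of
  every vertex of the clique \<open>R\<close>; two vertices of \<open>Q\<close> are within distance 1 anyway. So in
  the square each clique \<open>R\<close> can absorb all such vertices of \<open>Q\<close>, and \<open>Q\<close> itself can be
  dropped from the cover.
\<close>

lemma clique_cover_number_square_less:
  assumes cover: "clique_cover G C" and "Q \<in> C"
    and touch: "\<And>v. v \<in> Q \<Longrightarrow> closed_neighborhood G v \<inter> \<Union> (C - {Q}) \<noteq> {}"
  shows "clique_cover_number (graph_square G) < card C"
proof -
  define enlarge where "enlarge R = R \<union> {v \<in> Q. closed_neighborhood G v \<inter> R \<noteq> {}}" for R
  have clique: "is_clique G R" if "R \<in> C" for R
    using that cover by (auto simp: clique_cover_def)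
  have Q_verts: "Q \<subseteq> verts G" using clique[OF \<open>Q \<in> C\<close>] by (simp add: is_clique_def)
  have "is_clique (graph_square G) (enlarge R)" if R: "R \<in> C - {Q}" for R
    unfolding is_clique_graph_square_iff
  proof (intro conjI ballI)
    show "enlarge R \<subseteq> verts G"
      using clique[of R] R Q_verts by (auto simp: enlarge_def is_clique_def)
    have same: "closed_neighborhood G u \<inter> closed_neighborhood G v \<noteq> {}"
      if "is_clique G T" "u \<in> T" "v \<in> T" for u v T
      using clique_subset_closed_neighborhood[OF that(1)] that(2,3) by blast
    \<comment> \<open>A vertex \<open>v\<close> of \<open>R\<close> is adjacent or equal to the member of \<open>R\<close> near \<open>u\<close>.\<close>
    have mixed: "closed_neighborhood G u \<inter> closed_neighborhood G v \<noteq> {}"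
      if "u \<in> Q" "closed_neighborhood G u \<inter> R \<noteq> {}" "v \<in> R" for u v
      using clique_subset_closed_neighborhood[of G R v] clique[of R] R that by blast
    fix u v assume "u \<in> enlarge R" "v \<in> enlarge R"
    then consider "u \<in> R" "v \<in> R" | "u \<in> Q" "v \<in> Q"
      | "u \<in> Q" "closed_neighborhood G u \<inter> R \<noteq> {}" "v \<in> R"
      | "v \<in> Q" "closed_neighborhood G v \<inter> R \<noteq> {}" "u \<in> R"
      by (auto simp: enlarge_def)
    then show "closed_neighborhood G u \<inter> closed_neighborhood G v \<noteq> {}"
      using same[of R] same[of Q] clique R \<open>Q \<in> C\<close> mixed
      by cases (blast, blast, blast, metis Int_commute)
  qed
  moreover have "\<Union> (enlarge ` (C - {Q})) = verts G"
  proof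
    show "\<Union> (enlarge ` (C - {Q})) \<subseteq> verts G"
      using cover Q_verts by (auto simp: enlarge_def clique_cover_def)
    show "verts G \<subseteq> \<Union> (enlarge ` (C - {Q}))"
    proof
      fix v assume "v \<in> verts G"
      then obtain R where "R \<in> C" "v \<in> R" using cover by (auto simp: clique_cover_def)
      then show "v \<in> \<Union> (enlarge ` (C - {Q}))"
        using touch[of v] by (cases "R = Q") (auto simp: enlarge_def)
    qed
  qed
  ultimately have "clique_cover (graph_square G) (enlarge ` (C - {Q}))"
    by (auto simp: clique_cover_def)
  then have "clique_cover_number (graph_square G) \<le> card (enlarge ` (C - {Q}))"
    by (intro clique_cover_number_le) simp_all
  also have "\<dots> \<le> card (C - {Q})"
    using clique_cover_finite[OF _ cover] by (intro card_image_le) simp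
  also have "\<dots> < card C"
    using clique_cover_finite[OF _ cover] \<open>Q \<in> C\<close> by (intro psubset_card_mono) auto
  finally show ?thesis .
qed

lemma max_stable_two_packing_if_clique_cover_numbers_eq:
  assumes eq: "clique_cover_number G = clique_cover_number (graph_square G)"
  shows "\<exists>S \<in> max_stable_sets G. two_packing G S"
proof -
  obtain C where C: "clique_cover G C" "card C = clique_cover_number G"
    using obtain_minimum_clique_cover[of G] by auto
  have "\<exists>v \<in> Q. closed_neighborhood G v \<inter> \<Union> (C - {Q}) = {}" if "Q \<in> C" for Q
  proof (rule ccontr)
    assume "\<not> ?thesis"
    then have "clique_cover_number (graph_square G) < card C"
      by (intro clique_cover_number_square_less[OF C(1) that]) blast
    then show False using eq C(2) by simp
  qed
  then show ?thesis using max_stable_two_packing_if_private_vertices[OF C(1)] by blast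
qed

lemma closed_neighborhood_maximal_clique:
  assumes "is_clique G (closed_neighborhood G v)"
  shows "maximal_clique G (closed_neighborhood G v)"
  unfolding maximal_clique_def
proof (intro conjI allI impI)
  show "is_clique G (closed_neighborhood G v)" by fact
  fix R assume R: "is_clique G R \<and> closed_neighborhood G v \<subseteq> R"
  then have "v \<in> R" by (auto simp: closed_neighborhood_def)
  then have "R \<subseteq> closed_neighborhood G v"
    using R by (intro clique_subset_closed_neighborhood) auto
  then show "R = closed_neighborhood G v" using R by simp
qed

lemma is_clique_closed_neighborhood_iff:
  assumes "v \<in> verts G"
  shows "is_clique G (closed_neighborhood G v) \<longleftrightarrow> simplicial G v"
proof -
  have "neighborhood G v \<subseteq> verts G" "v \<notin> neighborhood G v"
    using adj_in_verts adj_not_same by (auto simp: neighborhood_def)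
  then show ?thesis
    using assms adjacent_sym
    unfolding is_clique_def simplicial_def closed_neighborhood_def
    by (metis insert_iff insert_subset mem_Collect_eq neighborhood_def)
qed

text \<open>
  A simplicial vertex lies in only one maximal clique, its closed neighborhood, so simplices can be
  handled as closed neighborhoods that happen to be cliques.
\<close>

lemma simplex_iff:
  "simplex G Q \<longleftrightarrow> (\<exists>v \<in> verts G. is_clique G (closed_neighborhood G v) \<and> Q = closed_neighborhood G v)"
proof
  assume "simplex G Q"
  then obtain v where v: "v \<in> Q" "simplicial G v" "maximal_clique G Q"
    by (auto simp: simplex_def)
  then have "v \<in> verts G" by (simp add: simplicial_def)
  moreover have clique: "is_clique G (closed_neighborhood G v)"
    using v(2) is_clique_closed_neighborhood_iff[OF \<open>v \<in> verts G\<close>] by simp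
  moreover have "Q = closed_neighborhood G v"
    using v clique clique_subset_closed_neighborhood[of G Q v] by (auto simp: maximal_clique_def)
  ultimately show "\<exists>v \<in> verts G. is_clique G (closed_neighborhood G v) \<and> Q = closed_neighborhood G v"
    by blast
next
  assume "\<exists>v \<in> verts G. is_clique G (closed_neighborhood G v) \<and> Q = closed_neighborhood G v"
  then obtain v where "v \<in> verts G" "is_clique G (closed_neighborhood G v)"
      "Q = closed_neighborhood G v"
    by blast
  then show "simplex G Q"
    using closed_neighborhood_maximal_clique is_clique_closed_neighborhood_iff
    by (auto simp: simplex_def closed_neighborhood_def)
qed

text \<open>
  The simplices cover the graph, and a simplicial vertex is private to its simplex, because its
  closed neighborhood is that simplex and distinct simplices do not share a vertex.
\<close>

lemma max_stable_two_packing_if_unique_simplices: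
  assumes unique: "\<forall>v \<in> verts G. \<exists>!Q. simplex G Q \<and> v \<in> Q"
  shows "\<exists>S \<in> max_stable_sets G. two_packing G S"
proof (rule max_stable_two_packing_if_private_vertices)
  have clique: "is_clique G Q" if "simplex G Q" for Q
    using that by (auto simp: simplex_def maximal_clique_def)
  then have subset: "Q \<subseteq> verts G" if "simplex G Q" for Q
    using that by (simp add: is_clique_def)
  then show "clique_cover G {Q. simplex G Q}"
    using clique unique by (auto simp: clique_cover_def)
  fix Q assume "Q \<in> {Q. simplex G Q}"
  then obtain v where v: "simplex G Q" "v \<in> Q" "Q = closed_neighborhood G v"
    by (auto simp: simplex_iff in_closed_neighborhood_iff)
  have "x \<notin> R" if "x \<in> Q" "simplex G R" "R \<noteq> Q" for x R
    using unique that v(1) subset by blast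
  then show "\<exists>v \<in> Q. closed_neighborhood G v \<inter> \<Union> ({Q. simplex G Q} - {Q}) = {}"
    using v by (intro bexI[of _ v]) auto
qed

end


section \<open>The structure given by a maximum stable 2-packing\<close>

locale max_stable_two_packing = graph G for G (structure) +
  fixes S
  assumes maximum: "S \<in> max_stable_sets G"
    and packing: "two_packing G S"
begin

text \<open>
  The closed neighborhoods around \<open>S\<close> partition the vertices; each vertex is sent to the
  member of \<open>S\<close> whose class contains it.
\<close>

definition center :: "'a \<Rightarrow> 'a" where
  "center v = (THE s. s \<in> S \<and> v \<in> closed_neighborhood G s)"

lemma stable: "stable_set G S"
  using maximum by (simp add: max_stable_sets_def)

lemma card_eq: "card S = stability_number G"
  using maximum by (simp add: max_stable_sets_def)

lemma subset_verts: "S \<subseteq> verts G"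
  using stable by (simp add: stable_set_def)

lemma finite_S: "finite S"
  using subset_verts by (rule finite_subset) simp

lemma center_eq:
  assumes "s \<in> S" "v \<in> closed_neighborhood G s"
  shows "center v = s"
  unfolding center_def using assms two_packingD[OF packing] by blast

lemma center:
  assumes "v \<in> verts G"
  shows "center v \<in> S" "v \<in> closed_neighborhood G (center v)"
proof -
  have "dominating_set G S"
    using maximal_stable_set_dominating[OF max_stable_set_is_maximal[OF maximum]] .
  then obtain s where "s \<in> S" "v \<in> closed_neighborhood G s"
    using assms adjacent_sym unfolding dominating_set_def in_closed_neighborhood_iff by blast
  then show "center v \<in> S" "v \<in> closed_neighborhood G (center v)" using center_eq by auto
qed

lemma adjacent_center: "v \<rightarrow> s \<Longrightarrow> s \<in> S \<Longrightarrow> center v = s"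
  using center_eq adjacent_sym by (simp add: in_closed_neighborhood_iff)

text \<open>
  If \<open>x\<close> and \<open>y\<close> were distinct non-adjacent members of the class of \<open>s\<close>, neither would have
  a neighbor in \<open>S\<close> other than \<open>s\<close>, and replacing \<open>s\<close> by the two would give a larger
  stable set.
\<close>

lemma closed_neighborhood_clique:
  assumes "s \<in> S"
  shows "is_clique G (closed_neighborhood G s)"
proof (rule ccontr)
  assume "\<not> ?thesis"
  moreover have "closed_neighborhood G s \<subseteq> verts G"
    using assms subset_verts closed_neighborhood_subset by blast
  ultimately obtain x y where xy: "x \<in> closed_neighborhood G s" "y \<in> closed_neighborhood G s"
      "x \<noteq> y" "\<not> x \<rightarrow> y" "x \<in> verts G" "y \<in> verts G"
    unfolding is_clique_def by blast
  have centers: "center x = s" "center y = s" using center_eq assms xy by auto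
  have not_s: "x \<noteq> s" "y \<noteq> s"
    using xy adjacent_sym by (auto simp: in_closed_neighborhood_iff)
  have new: "x \<notin> S" "y \<notin> S"
    using centers not_s center_eq[of x x] center_eq[of y y] by (auto simp: in_closed_neighborhood_iff)
  have "\<not> z \<rightarrow> t \<and> \<not> t \<rightarrow> z" if "center z = s" "t \<in> S - {s}" for z t
    using that adjacent_center adjacent_sym by blast
  moreover have "\<not> y \<rightarrow> x" using xy(4) adjacent_sym by blast
  ultimately have "stable_set G (insert x (insert y (S - {s})))"
    using stable xy(4-6) centers unfolding stable_set_def by blast
  then have "card (insert x (insert y (S - {s}))) \<le> card S"
    unfolding card_eq by (intro card_stable_le_stability_number) auto
  moreover have "card (insert x (insert y (S - {s}))) = Suc (card S)"
    using new xy(3) finite_S card_Suc_Diff1[OF finite_S assms] by simp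
  ultimately show False by simp
qed

lemma inj_on_center:
  assumes "stable_set G A"
  shows "inj_on center A"
proof (rule inj_onI, rule ccontr)
  fix a b assume ab: "a \<in> A" "b \<in> A" "center a = center b" "a \<noteq> b"
  then have verts: "a \<in> verts G" "b \<in> verts G" using assms by (auto simp: stable_set_def)
  then have "a \<rightarrow> b"
    using center[of a] center[of b] closed_neighborhood_clique[of "center a"] ab(3,4)
    by (auto simp: is_clique_def)
  then show False using assms ab by (auto simp: stable_set_def)
qed

text \<open>
  The simplex around a simplicial vertex \<open>q\<close> contains the class of \<open>q\<close>, which is itself a
  maximal clique; so the simplices are exactly the classes of the partition.
\<close>

lemma unique_simplex:
  assumes "v \<in> verts G"
  shows "\<exists>!Q. simplex G Q \<and> v \<in> Q"
proof (rule ex1I[of _ "closed_neighborhood G (center v)"])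
  show "simplex G (closed_neighborhood G (center v)) \<and> v \<in> closed_neighborhood G (center v)"
    using center[OF assms] closed_neighborhood_clique subset_verts by (auto simp: simplex_iff)
  fix Q assume Q: "simplex G Q \<and> v \<in> Q"
  then obtain q where q: "q \<in> verts G" "is_clique G Q" "Q = closed_neighborhood G q"
    by (auto simp: simplex_iff)
  have "closed_neighborhood G (center q) \<subseteq> Q"
    unfolding q(3) using closed_neighborhood_clique center[OF q(1)]
    by (intro clique_subset_closed_neighborhood) auto
  then have "Q = closed_neighborhood G (center q)"
    using closed_neighborhood_maximal_clique closed_neighborhood_clique center q
    by (meson maximal_clique_def)
  moreover from this have "center v = center q" using Q center_eq center q(1) by blast
  ultimately show "Q = closed_neighborhood G (center v)" by simp
qed

lemma clique_cover_closed_neighborhoods: "clique_cover G (closed_neighborhood G ` S)"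
  using closed_neighborhood_clique center closed_neighborhood_subset subset_verts
  by (fastforce simp: clique_cover_def)

lemma all_parameters_equal:
  "stability_number (graph_square G) = clique_cover_number (graph_square G)"
  "clique_cover_number (graph_square G) = domination_number G"
  "domination_number G = independent_domination_number G"
  "independent_domination_number G = stability_number G"
  "stability_number G = clique_cover_number G"
proof -
  have "clique_cover_number G \<le> card (closed_neighborhood G ` S)"
    using clique_cover_closed_neighborhoods by (intro clique_cover_number_le) auto
  also have "\<dots> \<le> card S" using finite_S by (rule card_image_le)
  also have "\<dots> \<le> stability_number (graph_square G)"
    using packing by (intro card_stable_le_stability_number) (auto simp: stable_set_graph_square_iff)
  finally have "clique_cover_number G \<le> stability_number (graph_square G)" .
  then show
    "stability_number (graph_square G) = clique_cover_number (graph_square G)"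
    "clique_cover_number (graph_square G) = domination_number G"
    "domination_number G = independent_domination_number G"
    "independent_domination_number G = stability_number G"
    "stability_number G = clique_cover_number G"
    using parameter_chain by linarith+
qed

text \<open>
  Each vertex of \<open>A\<close> takes the place of its only neighbor in \<open>S\<close>, and different vertices
  displace different neighbors, so the cardinality does not change.
\<close>

lemma property_P2: "property_P2 G S"
  unfolding property_P2_def
proof (intro conjI allI impI)
  show "stable_set G S" by (rule stable)
  fix A assume A: "stable_set G A \<and> A \<inter> S = {}"
  then have A_verts: "A \<subseteq> verts G" by (simp add: stable_set_def)
  then have "finite A" by (rule finite_subset) simp
  have centers: "center ` A \<subseteq> S" using A_verts center by auto
  have "\<not> a \<rightarrow> s \<and> \<not> s \<rightarrow> a" if "a \<in> A" "s \<in> S - center ` A" for a s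
    using that adjacent_center adjacent_sym by blast
  then have "stable_set G (A \<union> (S - center ` A))"
    using A stable by (auto simp: stable_set_def)
  moreover have "card (A \<union> (S - center ` A)) = card S"
  proof -
    have "card (A \<union> (S - center ` A)) = card A + card (S - center ` A)"
      using A \<open>finite A\<close> finite_S by (intro card_Un_disjoint) auto
    also have "\<dots> = card A + (card S - card A)"
      using A centers finite_S \<open>finite A\<close> card_image[OF inj_on_center[of A]]
      by (simp add: card_Diff_subset)
    also have "\<dots> = card S"
      using card_inj_on_le[OF inj_on_center[of A] centers finite_S] A by simp
    finally show ?thesis .
  qed
  ultimately have "A \<union> (S - center ` A) \<in> max_stable_sets G"
    by (simp add: max_stable_sets_def card_eq)
  then show "\<exists>S' \<subseteq> S. A \<union> S' \<in> max_stable_sets G" by blast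
qed

end


section \<open>Matchings\<close>

lemma undirected_edge_other_end:
  assumes "e \<in> undirected_edges G" "a \<in> e"
  obtains b where "e = {a, b}"
  using assms unfolding undirected_edges_def by blast

lemma (in graph) doubleton_edge_induced_iff:
  "{u, v} \<in> undirected_edges (G \<restriction> W) \<longleftrightarrow> u \<rightarrow> v \<and> u \<in> W \<and> v \<in> W"
proof -
  have "x \<rightarrow>\<^bsub>G \<restriction> W\<^esub> y \<longleftrightarrow> x \<rightarrow> y \<and> x \<in> W \<and> y \<in> W" for x y
    by (force simp: arcs_ends_conv)
  then show ?thesis
    unfolding undirected_edges_def mem_Collect_eq doubleton_eq_iff using adjacent_sym by blast
qed

lemma (in graph) doubleton_edge_iff: "{u, v} \<in> undirected_edges G \<longleftrightarrow> u \<rightarrow> v"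
  unfolding undirected_edges_def mem_Collect_eq doubleton_eq_iff using adjacent_sym by blast

text \<open>
  When the available edges are already pairwise disjoint, a vertex determines the edge that
  saturates it; this is where both uniqueness claims about matchings come from.
\<close>

lemma matching_eq_if_edges_disjoint:
  assumes "pairwise disjnt F" "\<And>e. e \<in> F \<Longrightarrow> e \<inter> A \<noteq> {}" "M \<subseteq> F" "A \<subseteq> \<Union>M"
  shows "M = F"
proof
  show "F \<subseteq> M"
  proof
    fix e assume "e \<in> F"
    then obtain a where "a \<in> e" "a \<in> A" using assms(2) by blast
    then obtain f where "f \<in> M" "a \<in> f" using assms(4) by blast
    then have "e = f"
      using assms(1,3) \<open>e \<in> F\<close> \<open>a \<in> e\<close> by (auto simp: pairwise_def disjnt_iff)
    then show "e \<in> M" using \<open>f \<in> M\<close> by simp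
  qed
qed fact

lemma induced_perfect_matching_if_edges_disjoint:
  assumes disjoint: "pairwise disjnt (undirected_edges H)"
    and cover: "\<Union> (undirected_edges H) = verts H"
  shows "\<exists>!M. perfect_matching H M" "\<exists>M. perfect_matching H M \<and> induced_matching H M"
proof -
  let ?E = "undirected_edges H"
  have matching: "is_matching H ?E"
    using disjoint by (auto simp: is_matching_def pairwise_def disjnt_def)
  then have perfect: "perfect_matching H ?E" using cover by (simp add: perfect_matching_def)
  show "\<exists>!M. perfect_matching H M"
  proof (rule ex1I[of _ ?E])
    fix M assume "perfect_matching H M"
    moreover have "e \<inter> verts H \<noteq> {}" if "e \<in> ?E" for e
    proof -
      obtain u where "u \<in> e" using \<open>e \<in> ?E\<close> unfolding undirected_edges_def by blast
      then show ?thesis using \<open>e \<in> ?E\<close> cover by blast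
    qed
    ultimately show "M = ?E"
      by (intro matching_eq_if_edges_disjoint[OF disjoint, of "verts H"])
        (simp_all add: perfect_matching_def is_matching_def)
  qed (rule perfect)
  have "e = f" if "e \<in> ?E" "f \<in> ?E" "u \<in> e" "v \<in> f" "u \<rightarrow>\<^bsub>H\<^esub> v" for e f u v
  proof -
    have "{u, v} \<in> ?E" using that by (auto simp: undirected_edges_def)
    then have "{u, v} = e" "{u, v} = f"
      using pairwiseD[OF disjoint, of "{u, v}" e] pairwiseD[OF disjoint, of "{u, v}" f] that
      by (auto simp: disjnt_iff)
    then show ?thesis by simp
  qed
  then have "induced_matching H ?E" using matching by (auto simp: induced_matching_def)
  then show "\<exists>M. perfect_matching H M \<and> induced_matching H M" using perfect by blast
qed

lemma card_le_if_matched: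
  assumes M: "is_matching G M" and mate: "\<And>a. a \<in> A \<Longrightarrow> \<exists>b \<in> B. {a, b} \<in> M"
    and "finite B"
  shows "card A \<le> card B"
proof -
  obtain f where f: "\<And>a. a \<in> A \<Longrightarrow> f a \<in> B \<and> {a, f a} \<in> M" using mate by metis
  have "inj_on f A"
  proof (rule inj_onI)
    fix a b assume ab: "a \<in> A" "b \<in> A" "f a = f b"
    then have "{a, f a} \<inter> {b, f b} \<noteq> {}" by simp
    moreover have "{a, f a} \<in> M" "{b, f b} \<in> M" using f ab(1,2) by blast+
    ultimately have "{a, f a} = {b, f b}" using M unfolding is_matching_def by metis
    then show "a = b" using ab(3) by (auto simp: doubleton_eq_iff)
  qed
  then show ?thesis using f \<open>finite B\<close> by (auto intro: card_inj_on_le)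
qed

lemma card_le_if_card_Diff_le:
  assumes "finite S" "finite T" "card (S - T) \<le> card (T - S)"
  shows "card S \<le> card T"
  using assms card_Int_Diff[of S T] card_Int_Diff[of T S] by (simp add: Int_commute)

context max_stable_two_packing
begin

lemma edges_into_packing_disjoint:
  assumes "stable_set G A" "A \<inter> S = {}"
    and "a \<in> A" "b \<in> A" "s \<in> S" "t \<in> S" "a \<rightarrow> s" "b \<rightarrow> t" "{a, s} \<noteq> {b, t}"
  shows "disjnt {a, s} {b, t}"
proof -
  have "center a = s" "center b = t" using assms adjacent_center by auto
  then have "a \<noteq> b" "s \<noteq> t"
    using assms inj_on_center[OF assms(1)] by (auto dest: inj_onD)
  then show ?thesis using assms by (auto simp: disjnt_iff)
qed

lemma neighbor_in_packing:
  assumes "stable_set G A" "A \<inter> S = {}" "a \<in> A"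
  shows "a \<rightarrow> center a"
proof -
  have "a \<in> verts G" using assms by (auto simp: stable_set_def)
  then show ?thesis
    using center[of a] assms adjacent_sym by (auto simp: in_closed_neighborhood_iff)
qed

lemma property_P1: "property_P1 G S"
  unfolding property_P1_def
proof (intro conjI allI impI)
  show "stable_set G S" by (rule stable)
  fix A assume A: "stable_set G A \<and> A \<inter> S = {}"
  define F where "F = {{a, s} | a s. a \<in> A \<and> s \<in> S \<and> a \<rightarrow> s}"
  have disjoint: "pairwise disjnt F"
  proof (rule pairwiseI)
    fix e f assume "e \<in> F" "f \<in> F" "e \<noteq> f"
    then obtain a s b t where "e = {a, s}" "f = {b, t}" "a \<in> A" "s \<in> S" "a \<rightarrow> s"
        "b \<in> A" "t \<in> S" "b \<rightarrow> t"
      unfolding F_def by blast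
    then show "disjnt e f"
      using edges_into_packing_disjoint[of A a b s t] A \<open>e \<noteq> f\<close> by simp
  qed
  have cover: "A \<subseteq> \<Union>F"
  proof
    fix a assume "a \<in> A"
    then have "a \<rightarrow> center a" using neighbor_in_packing A by blast
    moreover from this have "center a \<in> S" using center adj_in_verts by blast
    ultimately have "{a, center a} \<in> F" using \<open>a \<in> A\<close> by (auto simp: F_def)
    then show "a \<in> \<Union>F" by blast
  qed
  show "uniquely_matched_into G A S"
    unfolding uniquely_matched_into_def
  proof (rule ex1I[of _ F])
    have "is_matching G F"
      using disjoint by (auto simp: is_matching_def pairwise_def disjnt_def undirected_edges_def F_def)
    then show "is_matching G F \<and> (\<forall>e \<in> F. \<exists>a \<in> A. \<exists>s \<in> S. e = {a, s}) \<and> A \<subseteq> \<Union>F"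
      using cover by (auto simp: F_def)
    fix M assume "is_matching G M \<and> (\<forall>e \<in> M. \<exists>a \<in> A. \<exists>s \<in> S. e = {a, s}) \<and> A \<subseteq> \<Union>M"
    then have M: "is_matching G M" "\<And>e. e \<in> M \<Longrightarrow> \<exists>a \<in> A. \<exists>s \<in> S. e = {a, s}" "A \<subseteq> \<Union>M"
      by auto
    have "M \<subseteq> F"
    proof
      fix e assume "e \<in> M"
      then obtain a s where e: "a \<in> A" "s \<in> S" "e = {a, s}" using M(2) by meson
      moreover have "e \<in> undirected_edges G" using M(1) \<open>e \<in> M\<close> by (auto simp: is_matching_def)
      ultimately have "a \<rightarrow> s" using doubleton_edge_iff by simp
      then show "e \<in> F" using e by (auto simp: F_def)
    qed
    then show "M = F"
      using M(3) by (intro matching_eq_if_edges_disjoint[OF disjoint, of A]) (auto simp: F_def)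
  qed
qed

text \<open>
  Both \<open>T\<close> and \<open>S\<close> are stable, so all edges of the induced subgraph cross between
  \<open>T - S\<close> and \<open>S - T\<close>. As \<open>T\<close> and \<open>S\<close> have the same size, the injection
  sending each vertex of \<open>T - S\<close> to its only neighbor in \<open>S\<close> is onto \<open>S - T\<close>.
\<close>

lemma sym_diff_edges:
  assumes T: "T \<in> max_stable_sets G"
  defines "H \<equiv> G \<restriction> sym_diff T S"
  shows "pairwise disjnt (undirected_edges H)" "\<Union> (undirected_edges H) = verts H"
proof -
  have T_stable: "stable_set G T" and card_T: "card T = card S"
    using T card_eq by (auto simp: max_stable_sets_def)
  have "finite T" using T_stable by (auto simp: stable_set_def intro: finite_subset)
  have A: "stable_set G (T - S)" "(T - S) \<inter> S = {}"
    using T_stable by (auto simp: stable_set_def)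
  have edges: "undirected_edges H = {{a, s} | a s. a \<in> T - S \<and> s \<in> S - T \<and> a \<rightarrow> s}"
  proof (intro equalityI subsetI)
    fix e assume e: "e \<in> undirected_edges H"
    then obtain u v where "e = {u, v}" by (auto simp: undirected_edges_def)
    moreover from this have uv: "u \<rightarrow> v" "u \<in> sym_diff T S" "v \<in> sym_diff T S"
      using e unfolding H_def by (simp_all only: doubleton_edge_induced_iff)
    moreover have "\<not> (u \<in> T \<and> v \<in> T)" "\<not> (u \<in> S \<and> v \<in> S)"
      using uv(1) stable T_stable adj_not_same[of u] unfolding stable_set_def by metis+
    ultimately consider "e = {u, v}" "u \<in> T - S" "v \<in> S - T" "u \<rightarrow> v"
      | "e = {v, u}" "v \<in> T - S" "u \<in> S - T" "v \<rightarrow> u"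
      using adjacent_sym[of u v] by blast
    then show "e \<in> {{a, s} | a s. a \<in> T - S \<and> s \<in> S - T \<and> a \<rightarrow> s}"
      by cases blast+
  qed (auto simp: H_def doubleton_edge_induced_iff)
  show "pairwise disjnt (undirected_edges H)"
  proof (rule pairwiseI)
    fix e f assume "e \<in> undirected_edges H" "f \<in> undirected_edges H" "e \<noteq> f"
    then obtain a s b t where "e = {a, s}" "f = {b, t}" "a \<in> T - S" "s \<in> S" "a \<rightarrow> s"
        "b \<in> T - S" "t \<in> S" "b \<rightarrow> t"
      unfolding edges by blast
    then show "disjnt e f"
      using edges_into_packing_disjoint[OF A, of a b s t] \<open>e \<noteq> f\<close> by simp
  qed
  have mate: "a \<rightarrow> center a" "center a \<in> S - T" if "a \<in> T - S" for a
  proof -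
    show adjacent: "a \<rightarrow> center a" using neighbor_in_packing[OF A that] .
    have "center a \<in> S" using center adj_in_verts(1)[OF adjacent] by blast
    moreover have "center a \<notin> T"
      using adjacent that T_stable adj_not_same[of a] unfolding stable_set_def by (metis DiffD1)
    ultimately show "center a \<in> S - T" by blast
  qed
  have "card (center ` (T - S)) = card (S - T)"
    using card_image[OF inj_on_center[OF A(1)]] card_T finite_S \<open>finite T\<close>
      card_Int_Diff[of S T] card_Int_Diff[of T S] by (simp add: Int_commute)
  then have "center ` (T - S) = S - T"
    using mate(2) finite_S by (intro card_subset_eq) auto
  moreover have "{a, center a} \<in> undirected_edges H" if "a \<in> T - S" for a
    unfolding edges using mate[OF that] that by blast
  ultimately have "sym_diff T S \<subseteq> \<Union> (undirected_edges H)" by blast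
  moreover have "\<Union> (undirected_edges H) \<subseteq> sym_diff T S" unfolding edges by blast
  ultimately have "\<Union> (undirected_edges H) = sym_diff T S" by (rule equalityI[rotated])
  then show "\<Union> (undirected_edges H) = verts H" by (simp add: H_def)
qed

end

context graph
begin

text \<open>
  P1 matches \<open>T - S\<close> into \<open>S\<close>. The partners lie outside \<open>T\<close> because \<open>T\<close> is stable, so
  \<open>T - S\<close> is no larger than \<open>S - T\<close>.
\<close>

lemma card_le_if_property_P1:
  assumes P1: "property_P1 G S" and T: "stable_set G T"
  shows "card T \<le> card S"
proof -
  have S: "stable_set G S" using P1 by (simp add: property_P1_def)
  have finite: "finite S" "finite T" using S T by (auto simp: stable_set_def intro: finite_subset)
  have "stable_set G (T - S)" "(T - S) \<inter> S = {}" using T by (auto simp: stable_set_def)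
  then obtain M where M: "is_matching G M" "\<forall>e \<in> M. \<exists>a \<in> T - S. \<exists>s \<in> S. e = {a, s}" "T - S \<subseteq> \<Union>M"
    using P1 unfolding property_P1_def uniquely_matched_into_def by meson
  have "\<exists>b \<in> S - T. {a, b} \<in> M" if a: "a \<in> T - S" for a
  proof -
    obtain e where e: "e \<in> M" "a \<in> e" using M(3) a by blast
    then obtain a' s where "a' \<in> T - S" "s \<in> S" "e = {a', s}" using M(2) by blast
    then have s: "s \<in> S" "{a, s} \<in> M" using e a by auto
    then have "a \<rightarrow> s" using M(1) doubleton_edge_iff by (auto simp: is_matching_def)
    then have "s \<notin> T" using T a s by (auto simp: stable_set_def)
    then show ?thesis using s by blast
  qed
  then have "card (T - S) \<le> card (S - T)"
    using card_le_if_matched[OF M(1)] finite by blast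
  then show ?thesis using card_le_if_card_Diff_le finite by blast
qed

lemma card_le_if_perfect_matching_sym_diff:
  assumes S: "stable_set G S" and T: "stable_set G T"
    and M: "perfect_matching (G \<restriction> sym_diff T S) M"
  shows "card T \<le> card S"
proof -
  have finite: "finite S" "finite T" using S T by (auto simp: stable_set_def intro: finite_subset)
  have "\<exists>b \<in> S - T. {a, b} \<in> M" if "a \<in> T - S" for a
  proof -
    have "a \<in> \<Union>M" using M that by (simp add: perfect_matching_def)
    then obtain e where "e \<in> M" "a \<in> e" by blast
    moreover from this have edge: "e \<in> undirected_edges (G \<restriction> sym_diff T S)"
      using M by (auto simp: perfect_matching_def is_matching_def)
    ultimately obtain b where "e = {a, b}" using undirected_edge_other_end by metis
    then have b: "{a, b} \<in> M" "a \<rightarrow> b" "b \<in> sym_diff T S"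
      using edge \<open>e \<in> M\<close> by (simp_all only: doubleton_edge_induced_iff)
    then have "b \<notin> T" using T that adj_not_same[of a] unfolding stable_set_def by (metis DiffD1)
    then show ?thesis using b by blast
  qed
  then have "card (T - S) \<le> card (S - T)"
    using card_le_if_matched[of _ M "T - S" "S - T"] M finite
    by (auto simp: perfect_matching_def)
  then show ?thesis using card_le_if_card_Diff_le finite by blast
qed

text \<open>
  Two neighbors in \<open>S\<close> of one outer vertex \<open>v\<close> would give two matchings of \<open>{v}\<close> into \<open>S\<close>.
\<close>

lemma two_packing_if_property_P1:
  assumes P1: "property_P1 G S"
  shows "two_packing G S"
proof -
  have S: "stable_set G S" using P1 by (simp add: property_P1_def)
  have "a = b" if "v \<in> verts G - S" "a \<in> S" "b \<in> S" "v \<rightarrow> a" "v \<rightarrow> b" for v a b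
  proof -
    have "stable_set G {v}" "{v} \<inter> S = {}" using that by (auto simp: stable_set_def)
    then have unique: "uniquely_matched_into G {v} S" using P1 by (auto simp: property_P1_def)
    have "is_matching G {{v, s}} \<and> (\<forall>e \<in> {{v, s}}. \<exists>x \<in> {v}. \<exists>s \<in> S. e = {x, s}) \<and>
        {v} \<subseteq> \<Union> {{v, s}}" if "s \<in> S" "v \<rightarrow> s" for s
      using that by (auto simp: is_matching_def undirected_edges_def)
    then have "{{v, a}} = {{v, b}}"
      using that(2-5) by (intro Uniq_D[OF unique[unfolded uniquely_matched_into_def ex1_iff_ex_Uniq, THEN conjunct2]])
    then show ?thesis by (auto simp: doubleton_eq_iff)
  qed
  then show ?thesis using two_packing_iff_unique_neighbor[OF S] by blast
qed

text \<open>
  A stable set that contains \<open>v\<close> omits all neighbors of \<open>v\<close>. If two of these lay in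
  \<open>S\<close>, then \<open>v\<close> together with a subset of \<open>S\<close> could not reach the size of \<open>S\<close>.
\<close>

lemma two_packing_if_property_P2:
  assumes S: "S \<in> max_stable_sets G" and P2: "property_P2 G S"
  shows "two_packing G S"
proof -
  have stable: "stable_set G S" and card: "card S = stability_number G"
    using S by (auto simp: max_stable_sets_def)
  have "finite S" using stable by (auto simp: stable_set_def intro: finite_subset)
  have "a = b" if v: "v \<in> verts G - S" "a \<in> S" "b \<in> S" "v \<rightarrow> a" "v \<rightarrow> b" for v a b
  proof (rule ccontr)
    assume "a \<noteq> b"
    have "stable_set G {v}" "{v} \<inter> S = {}" using v by (auto simp: stable_set_def)
    then obtain S' where S': "S' \<subseteq> S" "{v} \<union> S' \<in> max_stable_sets G"
      using P2 unfolding property_P2_def by meson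
    then have "a \<notin> S'" "b \<notin> S'"
      using v by (auto simp: max_stable_sets_def stable_set_def)
    then have "S' \<subseteq> S - {a, b}" using S'(1) by blast
    then have "card S' \<le> card (S - {a, b})" using \<open>finite S\<close> by (intro card_mono) auto
    also have "\<dots> = card S - 2" using v \<open>a \<noteq> b\<close> by (simp add: card_Diff_subset)
    finally have "card S' \<le> card S - 2" .
    moreover have "card S \<ge> 2"
      using card_mono[OF \<open>finite S\<close>, of "{a, b}"] v \<open>a \<noteq> b\<close> by simp
    moreover have "card S = Suc (card S')"
    proof -
      have "v \<notin> S'" "finite S'" using S'(1) v(1) finite_subset[OF S'(1) \<open>finite S\<close>] by auto
      then show ?thesis using S'(2) card by (simp add: max_stable_sets_def)
    qed
    ultimately show False by simp
  qed
  then show ?thesis using two_packing_iff_unique_neighbor[OF stable] by blast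
qed


section \<open>The equivalences\<close>

lemma max_stable_sets_graph_squareD:
  assumes "S \<in> max_stable_sets (graph_square G)"
  shows "two_packing G S" "stable_set G S" "card S = stability_number (graph_square G)"
  using assms two_packing_imp_stable
  by (auto simp: max_stable_sets_def stable_set_graph_square_iff)

text \<open>
  One maximum stable 2-packing forces \<open>\<alpha>(G\<^sup>2) = \<alpha>(G)\<close>, and then every maximum stable set of the
  square has the same structure.
\<close>

lemma max_stable_square_is_max_stable_two_packing:
  assumes "\<exists>S \<in> max_stable_sets G. two_packing G S"
    and S: "S \<in> max_stable_sets (graph_square G)"
  shows "max_stable_two_packing G S"
proof -
  obtain T where "T \<in> max_stable_sets G" "two_packing G T" using assms(1) by blast
  then interpret T: max_stable_two_packing G T by unfold_locales
  have "S \<in> max_stable_sets G"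
    using max_stable_sets_graph_squareD[OF S] T.all_parameters_equal
    by (auto simp: max_stable_sets_def)
  then show ?thesis using max_stable_sets_graph_squareD[OF S] by unfold_locales
qed

end

lemma tfaeI: "\<forall>p \<in> set ps. p \<longleftrightarrow> R \<Longrightarrow> tfae ps"
  by (auto simp: tfae_def)

theorem theorem2p14:
  fixes G :: "('a,'b) pre_digraph"
  assumes "graph G" and "Digraph_Component.connected G" and "verts G \<noteq> {}"
  shows "tfae
    [\<forall>v \<in> verts G. \<exists>!Q. simplex G Q \<and> v \<in> Q,
     stability_number G = stability_number (graph_square G),
     clique_cover_number G = clique_cover_number (graph_square G),
     stability_number (graph_square G) = clique_cover_number (graph_square G) \<and>
       clique_cover_number (graph_square G) = domination_number G \<and>
       domination_number G = independent_domination_number G \<and>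
       independent_domination_number G = stability_number G \<and>
       stability_number G = clique_cover_number G,
     max_stable_sets (graph_square G) \<subseteq> max_stable_sets G,
     \<exists>S \<in> max_stable_sets G. \<forall>a \<in> S. \<forall>b \<in> S. a \<noteq> b \<longrightarrow> gdist G a b \<ge> 3,
     \<exists>S\<^sub>0 \<in> max_stable_sets G. property_P1 G S\<^sub>0,
     \<forall>S \<in> max_stable_sets (graph_square G). property_P1 G S,
     \<forall>S\<^sub>1 \<in> max_stable_sets G. \<forall>S\<^sub>2 \<in> max_stable_sets (graph_square G).
       \<exists>!M. perfect_matching (G \<restriction> sym_diff S\<^sub>1 S\<^sub>2) M,
     \<forall>S\<^sub>1 \<in> max_stable_sets G. \<forall>S\<^sub>2 \<in> max_stable_sets (graph_square G).
       \<exists>M. perfect_matching (G \<restriction> sym_diff S\<^sub>1 S\<^sub>2) M,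
     \<forall>S\<^sub>1 \<in> max_stable_sets G. \<forall>S\<^sub>2 \<in> max_stable_sets (graph_square G).
       \<exists>M. perfect_matching (G \<restriction> sym_diff S\<^sub>1 S\<^sub>2) M \<and>
           induced_matching (G \<restriction> sym_diff S\<^sub>1 S\<^sub>2) M,
     \<exists>S\<^sub>0 \<in> max_stable_sets G. property_P2 G S\<^sub>0,
     \<forall>S \<in> max_stable_sets (graph_square G). property_P2 G S]"
proof -
  interpret graph G by fact
  let ?packed = "\<exists>S \<in> max_stable_sets G. two_packing G S"
  let ?parameters = "stability_number (graph_square G) = clique_cover_number (graph_square G) \<and>
       clique_cover_number (graph_square G) = domination_number G \<and>
       domination_number G = independent_domination_number G \<and>
       independent_domination_number G = stability_number G \<and>
       stability_number G = clique_cover_number G"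
  obtain S where S: "S \<in> max_stable_sets (graph_square G)"
    using max_stable_sets_nonempty[of "graph_square G"] by auto
  obtain T where T: "T \<in> max_stable_sets G" using max_stable_sets_nonempty[of G] by auto
  then have T_stable: "stable_set G T" and T_card: "card T = stability_number G"
    by (auto simp: max_stable_sets_def)
  note S_props = max_stable_sets_graph_squareD[OF S]
  have structured: "max_stable_two_packing G S'"
    if ?packed "S' \<in> max_stable_sets (graph_square G)" for S'
    using max_stable_square_is_max_stable_two_packing that .
  \<comment> \<open>A maximum stable set of the square is a 2-packing, so only its size is in question.\<close>
  have packed_if_large: ?packed if "stability_number G \<le> card S"
    using that S_props max_stable_setsI[of G S] by auto
  have parameters: ?parameters if ?packed
    using max_stable_two_packing.all_parameters_equal[OF structured[OF that S]] by blast
  have S_good: "S \<in> max_stable_sets G" "property_P1 G S" "property_P2 G S" if ?packed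
    using max_stable_two_packing.maximum[OF structured[OF that S]]
      max_stable_two_packing.property_P1[OF structured[OF that S]]
      max_stable_two_packing.property_P2[OF structured[OF that S]] by auto

  have i: "(\<forall>v \<in> verts G. \<exists>!Q. simplex G Q \<and> v \<in> Q) \<longleftrightarrow> ?packed"
  proof
    assume ?packed
    then interpret max_stable_two_packing G S using structured S by blast
    show "\<forall>v \<in> verts G. \<exists>!Q. simplex G Q \<and> v \<in> Q" using unique_simplex by blast
  qed (rule max_stable_two_packing_if_unique_simplices)
  have ii: "stability_number G = stability_number (graph_square G) \<longleftrightarrow> ?packed"
    using packed_if_large S_props(3) parameters by (metis order_refl)
  have iii: "clique_cover_number G = clique_cover_number (graph_square G) \<longleftrightarrow> ?packed"
    using max_stable_two_packing_if_clique_cover_numbers_eq parameters by metis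
  have iv: "?parameters \<longleftrightarrow> ?packed" using ii parameters by metis
  have v: "max_stable_sets (graph_square G) \<subseteq> max_stable_sets G \<longleftrightarrow> ?packed"
  proof
    assume ?packed
    then show "max_stable_sets (graph_square G) \<subseteq> max_stable_sets G"
      using max_stable_two_packing.maximum structured by blast
  qed (use S S_props(1) in blast)
  have vi: "(\<exists>S \<in> max_stable_sets G. \<forall>a \<in> S. \<forall>b \<in> S. a \<noteq> b \<longrightarrow> gdist G a b \<ge> 3) \<longleftrightarrow> ?packed"
    by (intro bex_cong refl two_packing_iff_gdist[symmetric])
      (simp add: max_stable_sets_def stable_set_def)
  have vii: "(\<exists>S\<^sub>0 \<in> max_stable_sets G. property_P1 G S\<^sub>0) \<longleftrightarrow> ?packed"
    using two_packing_if_property_P1 S_good by blast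
  have viii: "(\<forall>S \<in> max_stable_sets (graph_square G). property_P1 G S) \<longleftrightarrow> ?packed"
  proof
    assume "\<forall>S \<in> max_stable_sets (graph_square G). property_P1 G S"
    then have "property_P1 G S" using S by blast
    then show ?packed using packed_if_large card_le_if_property_P1[OF _ T_stable] T_card by simp
  qed (use max_stable_two_packing.property_P1 structured in blast)
  have xii: "(\<exists>S\<^sub>0 \<in> max_stable_sets G. property_P2 G S\<^sub>0) \<longleftrightarrow> ?packed"
    using two_packing_if_property_P2 S_good by blast
  have xiii: "(\<forall>S \<in> max_stable_sets (graph_square G). property_P2 G S) \<longleftrightarrow> ?packed"
  proof
    assume "\<forall>S \<in> max_stable_sets (graph_square G). property_P2 G S"
    then have P2: "property_P2 G S" using S by blast
    \<comment> \<open>The empty stable set suffices: a part of \<open>S\<close> is then a maximum stable set of \<open>G\<close>.\<close>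
    have "stable_set G {}" by (simp add: stable_set_def)
    then obtain S' where S': "S' \<subseteq> S" "S' \<in> max_stable_sets G"
      using P2[unfolded property_P2_def, THEN conjunct2, THEN spec, of "{}"] by auto
    have "finite S" using S_props(2) by (auto simp: stable_set_def intro: finite_subset)
    then have "card S' \<le> card S" using S'(1) by (intro card_mono)
    then show ?packed using packed_if_large S'(2) by (simp add: max_stable_sets_def)
  qed (use max_stable_two_packing.property_P2 structured in blast)

  have matching_packed: ?packed
    if matched: "\<forall>S\<^sub>1 \<in> max_stable_sets G. \<forall>S\<^sub>2 \<in> max_stable_sets (graph_square G).
      \<exists>M. perfect_matching (G \<restriction> sym_diff S\<^sub>1 S\<^sub>2) M"
  proof -
    obtain M where "perfect_matching (G \<restriction> sym_diff T S) M" using matched S T by blast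
    then show ?packed
      using card_le_if_perfect_matching_sym_diff[OF S_props(2) T_stable] packed_if_large T_card
      by simp
  qed
  have packed_matching:
    "\<exists>!M. perfect_matching (G \<restriction> sym_diff S\<^sub>1 S\<^sub>2) M"
    "\<exists>M. perfect_matching (G \<restriction> sym_diff S\<^sub>1 S\<^sub>2) M \<and>
      induced_matching (G \<restriction> sym_diff S\<^sub>1 S\<^sub>2) M"
    if ?packed "S\<^sub>1 \<in> max_stable_sets G" "S\<^sub>2 \<in> max_stable_sets (graph_square G)" for S\<^sub>1 S\<^sub>2
  proof -
    interpret max_stable_two_packing G S\<^sub>2 using structured that(1,3) .
    show "\<exists>!M. perfect_matching (G \<restriction> sym_diff S\<^sub>1 S\<^sub>2) M"
      "\<exists>M. perfect_matching (G \<restriction> sym_diff S\<^sub>1 S\<^sub>2) M \<and>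
        induced_matching (G \<restriction> sym_diff S\<^sub>1 S\<^sub>2) M"
      using induced_perfect_matching_if_edges_disjoint sym_diff_edges[OF that(2)] by blast+
  qed
  have ix: "(\<forall>S\<^sub>1 \<in> max_stable_sets G. \<forall>S\<^sub>2 \<in> max_stable_sets (graph_square G).
      \<exists>!M. perfect_matching (G \<restriction> sym_diff S\<^sub>1 S\<^sub>2) M) \<longleftrightarrow> ?packed"
    (is "?all \<longleftrightarrow> _")
  proof
    assume ?all
    then show ?packed by (intro matching_packed) (blast dest: ex1_implies_ex)
  qed (intro ballI packed_matching(1))
  have x: "(\<forall>S\<^sub>1 \<in> max_stable_sets G. \<forall>S\<^sub>2 \<in> max_stable_sets (graph_square G).
      \<exists>M. perfect_matching (G \<restriction> sym_diff S\<^sub>1 S\<^sub>2) M) \<longleftrightarrow> ?packed"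
    (is "?all \<longleftrightarrow> _")
  proof
    assume ?all
    then show ?packed by (intro matching_packed) blast
  next
    assume ?packed
    then show ?all using packed_matching(2) by blast
  qed
  have xi: "(\<forall>S\<^sub>1 \<in> max_stable_sets G. \<forall>S\<^sub>2 \<in> max_stable_sets (graph_square G).
      \<exists>M. perfect_matching (G \<restriction> sym_diff S\<^sub>1 S\<^sub>2) M \<and>
        induced_matching (G \<restriction> sym_diff S\<^sub>1 S\<^sub>2) M) \<longleftrightarrow> ?packed"
    (is "?all \<longleftrightarrow> _")
  proof
    assume ?all
    then show ?packed by (intro matching_packed) blast
  next
    assume ?packed
    then show ?all using packed_matching(2) by blast
  qed

  show ?thesis
    by (rule tfaeI[of _ ?packed], simp only: list.set ball_simps)
      (intro conjI TrueI i ii iii iv v vi vii viii ix x xi xii xiii)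
qed

end
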